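(* For each integer $n\ge 1$ let $t_k=\frac{k}{n}$, $k=0,\ldots,n-1$, and let $\boldsymbol{w}^*=(w_k^* )_{k=0}^{n-1}\in\mathbb{R}^n$ (depending on $n$) be the solution of the linear system $$\sum_{\ell=0}^{n-1}K^1(t_k,t_\ell)\,w_\ell^*=1,\qquad k=0,\ldots,n-1,$$ where $K^1(x,y)=1+\tfrac12 B_2(|x-y|)+(x-\tfrac12)(y-\tfrac12)$ for $x,y\in[0,1]$ and $B_2(x)=x^2-x+\tfrac16$. Let $If=\int_0^1 f(y)\,\mathrm{d}y$ and $Q_{\boldsymbol{T}}^{\boldsymbol{w}^*}f=\sum_{k=0}^{n-1}w_k^*f(t_k)$. Suppose that $f\in\mathcal{H}^2_{1,\mathbf{1}}$, the one-dimensional Sobolev space of smoothness $2$ on $[0,1]$. Then $$|If-Q_{\boldsymbol{T}}^{\boldsymbol{w}^*}f|=\mathcal{O}(n^{-2})\qquad\text{as } n\to\infty.$$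
   Context: For $\alpha\in\{1,2,\ldots\}$, $\mathcal{H}^\alpha_{1,\mathbf{1}}$ denotes the one-dimensional (unit coordinate weight) Sobolev space of order $\alpha$ on $[0,1]$: the reproducing kernel Hilbert space of functions $f\colon[0,1]\to\mathbb{R}$ (with $f,\ldots,f^{(\alpha-1)}$ absolutely continuous and $f^{(\alpha)}\in L^2(0,1)$) with inner product $$\langle f,g\rangle=\Big(\int_0^1 f\,\mathrm{d}x\Big)\Big(\int_0^1 g\,\mathrm{d}x\Big)+\sum_{\tau=1}^{\alpha-1}\Big(\int_0^1 f^{(\tau)}\,\mathrm{d}x\Big)\Big(\int_0^1 g^{(\tau)}\,\mathrm{d}x\Big)+\int_0^1 f^{(\alpha)}g^{(\alpha)}\,\mathrm{d}x$$ and reproducing kernel $$K^\alpha(x,y)=1+\sum_{\tau=1}^\alpha\frac{B_\tau(x)}{\tau!}\frac{B_\tau(y)}{\tau!}+(-1)^{\alpha+1}\frac{B_{2\alpha}(\{x-y\})}{(2\alpha)!},$$ where $B_m$ is the Bernoulli polynomial of degree $m$ and $\{\cdot\}$ is the fractional part. For $\alpha=1$ this kernel is the $K^1$ in the claim. The weights $\boldsymbol{w}^*$ are the optimal (kernel cubature) weights for $\mathcal{H}^1_{1,\mathbf{1}}$ and the points $t_k$: the right-hand side of the linear system is $h(t_k)$ with $h=\int_0^1K^1(\cdot,y)\,\mathrm{d}y\equiv1$. The kernel $K^1$ is strictly positive definite, so the solution is unique. The constant implied in $\mathcal{O}(n^{-2})$ may depend on $f$ but not on $n$. *)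

theory Defs
  imports "HOL-Analysis.Analysis" "HOL-Library.Landau_Symbols"
begin

text \<open>Each pair \<open>(a, b)\<close> below stands for a nondegenerate interval; the intervals may share end points.\<close>

definition abs_continuous_on :: "real set \<Rightarrow> (real \<Rightarrow> real) \<Rightarrow> bool" where
  "abs_continuous_on S f \<longleftrightarrow>
     (\<forall>\<epsilon>>0. \<exists>\<delta>>0. \<forall>P :: (real \<times> real) set.
        finite P \<and> (\<forall>(a, b)\<in>P. a < b \<and> {a..b} \<subseteq> S) \<and>
        disjoint_family_on (\<lambda>(a, b). {a<..<b}) P \<and>
        (\<Sum>(a, b)\<in>P. b - a) < \<delta>
        \<longrightarrow> (\<Sum>(a, b)\<in>P. \<bar>f b - f a\<bar>) < \<epsilon>)"

definition L2_01 :: "(real \<Rightarrow> real) set" where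
  "L2_01 = {g. g \<in> borel_measurable (lebesgue_on {0<..<1}) \<and>
               integrable (lebesgue_on {0<..<1}) (\<lambda>x. (g x)\<^sup>2)}"

text \<open>
  The functions on \<open>[0,1]\<close> underlying the Sobolev space of order \<open>\<alpha> \<ge> 1\<close>, as functions on the reals
  whose values outside \<open>[0,1]\<close> play no role. \<open>D \<tau>\<close> is the \<open>\<tau>\<close>-th derivative of \<open>f\<close>: a classical one
  (one-sided at the end points) for \<open>\<tau> < \<alpha>\<close>, and one almost everywhere for \<open>\<tau> = \<alpha>\<close>.
\<close>

definition sobolev :: "nat \<Rightarrow> (real \<Rightarrow> real) set" where
  "sobolev \<alpha> = {f. \<alpha> \<ge> 1 \<and> (\<exists>D :: nat \<Rightarrow> real \<Rightarrow> real.
      D 0 = f \<and>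
      (\<forall>\<tau><\<alpha>. abs_continuous_on {0..1} (D \<tau>)) \<and>
      (\<forall>\<tau><\<alpha> - 1. \<forall>x\<in>{0..1}. (D \<tau> has_real_derivative D (Suc \<tau>) x) (at x within {0..1})) \<and>
      (AE x in lebesgue_on {0<..<1}. (D (\<alpha> - 1) has_real_derivative D \<alpha> x) (at x)) \<and>
      D \<alpha> \<in> L2_01)}"

definition B2 :: "real \<Rightarrow> real" where
  "B2 x = x\<^sup>2 - x + 1 / 6"

definition K1 :: "real \<Rightarrow> real \<Rightarrow> real" where
  "K1 x y = 1 + 1 / 2 * B2 \<bar>x - y\<bar> + (x - 1 / 2) * (y - 1 / 2)"

definition node :: "nat \<Rightarrow> nat \<Rightarrow> real" where
  "node n k = real k / real n"

text \<open>A vector in \<open>\<real>\<^sup>n\<close> is given by the values of a function at the indices below \<open>n\<close>.\<close>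

definition optimal_weights :: "nat \<Rightarrow> (nat \<Rightarrow> real) \<Rightarrow> bool" where
  "optimal_weights n w \<longleftrightarrow> (\<forall>k<n. (\<Sum>l<n. K1 (node n k) (node n l) * w l) = 1)"

definition quadrature :: "nat \<Rightarrow> (nat \<Rightarrow> real) \<Rightarrow> (real \<Rightarrow> real) \<Rightarrow> real" where
  "quadrature n w f = (\<Sum>k<n. w k * f (node n k))"

end

theory Submission
  imports Defs "HOL-Real_Asymp.Real_Asymp"
begin

text \<open>
  Since \<open>K1 x y = 4/3 + x\<^sup>2/2 + y\<^sup>2/2 - max x y\<close>, subtracting consecutive equations of the linear system
  gives the partial sums of the weights in terms of their total \<open>W\<close>, and the quadrature becomes \<open>W\<close>
  times the trapezoidal rule on \<open>[0, 1 - 1/n]\<close> plus a left rectangle on the last panel. The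
  first equation says that this is exact for \<open>g x = 4/3 + x\<^sup>2/2 - x\<close>, whose integral is \<open>1\<close>. For a
  function with absolutely continuous derivative the rule without the factor \<open>W\<close> has error
  \<open>O(n\<^sup>-\<^sup>2)\<close>, because the trapezoidal error on a panel is at most \<open>n\<^sup>-\<^sup>2/2\<close> times an increment of the
  derivative within the panel. Applied to \<open>g\<close>, this gives \<open>W = 1 + O(n\<^sup>-\<^sup>2)\<close>, and the claim follows by
  applying it to \<open>f\<close>.
\<close>

section \<open>The optimal weights and the quadrature rule they define\<close>

definition trapezoid_rectangle :: "nat \<Rightarrow> (real \<Rightarrow> real) \<Rightarrow> real" where
  "trapezoid_rectangle n f =
     ((\<Sum>k<n-1. (f (node n k) + f (node n (Suc k))) / 2) + f (node n (n - 1))) / real n"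

text \<open>The cross terms \<open>x * y\<close> of \<open>B2\<close> and of the product cancel, and
  half of \<open>\<bar>x - y\<bar> + x + y\<close> is the maximum. Apart from \<open>max x y\<close>
  the kernel is thus a function of \<open>x\<close> plus a function of \<open>y\<close>, which makes
  differences of its rows simple.\<close>

lemma K1_eq_max: "K1 x y = 4/3 + x\<^sup>2 / 2 + y\<^sup>2 / 2 - max x y"
  unfolding K1_def B2_def by (simp add: max_def power2_eq_square field_simps)

text \<open>Passing from row \<open>k\<close> to row \<open>Suc k\<close> changes the quadratic part
  by an amount independent of \<open>l\<close>, and changes \<open>max k l\<close> by 1 exactly when
  \<open>l \<le> k\<close>. Both right-hand sides are 1, so pairing the difference of the rows with
  \<open>w\<close> leaves a multiple of the total balanced against a partial sum.\<close>

lemma optimal_weights_partial_sums: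
  assumes w: "optimal_weights n w" and k: "Suc k < n"
  shows "(\<Sum>l<Suc k. w l) = (\<Sum>l<n. w l) * (2 * real k + 1) / (2 * real n)"
proof -
  let ?h = "1 / real n"
  have n: "real n > 0" using k by simp
  have *: "K1 (node n (Suc k)) (node n l) * w l - K1 (node n k) (node n l) * w l =
           (2 * real k + 1) / (2 * (real n)\<^sup>2) * w l - (if l < Suc k then ?h * w l else 0)" for l
  proof -
    have m: "max (node n i) (node n l) = real (max i l) / real n" for i
      using n by (simp add: node_def max_def divide_le_cancel)
    have "K1 (node n (Suc k)) (node n l) - K1 (node n k) (node n l) =
           (2 * real k + 1) / (2 * (real n)\<^sup>2) - (if l < Suc k then ?h else 0)"
      unfolding K1_eq_max m using n
      by (auto simp: node_def max_def field_simps power2_eq_square)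
    then show ?thesis by (simp flip: left_diff_distrib) (simp add: left_diff_distrib)
  qed
  have "0 = (\<Sum>l<n. K1 (node n (Suc k)) (node n l) * w l) - (\<Sum>l<n. K1 (node n k) (node n l) * w l)"
    using w k unfolding optimal_weights_def by simp
  also have "\<dots> = (\<Sum>l<n. (2 * real k + 1) / (2 * (real n)\<^sup>2) * w l - (if l < Suc k then ?h * w l else 0))"
    by (simp only: * flip: sum_subtractf)
  also have "\<dots> = (2 * real k + 1) / (2 * (real n)\<^sup>2) * (\<Sum>l<n. w l)
                 - (\<Sum>l<n. if l < Suc k then ?h * w l else 0)"
    by (simp only: sum_subtractf sum_distrib_left)
  also have "(\<Sum>l<n. if l < Suc k then ?h * w l else 0) = (\<Sum>l<Suc k. ?h * w l)"
    using k by (intro sum.mono_neutral_cong_right) auto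
  also have "\<dots> = ?h * (\<Sum>l<Suc k. w l)"
    by (simp only: sum_distrib_left)
  finally have "?h * (\<Sum>l<Suc k. w l) = ?h * ((\<Sum>l<n. w l) * (2 * real k + 1) / (2 * real n))"
    by (simp add: power2_eq_square mult_ac del: sum.lessThan_Suc)
  then show ?thesis
    by (subst (asm) mult_cancel_left) (use n in simp)
qed

text \<open>Differences of the partial sums show that the weights are \<open>W / (2 * n)\<close> at
  the first node, \<open>W / n\<close> at the inner nodes and \<open>3 * W / (2 * n)\<close> at the
  last one. The last value is half a trapezoid from the panel on the left plus a full rectangle on
  the panel on the right.\<close>

lemma optimal_quadrature_eq:
  assumes w: "optimal_weights n w" and n: "n \<ge> 2"
  shows "quadrature n w f = (\<Sum>l<n. w l) * trapezoid_rectangle n f"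
proof -
  define W where "W = (\<Sum>l<n. w l)"
  define F where "F k = f (node n k)" for k
  have S: "(\<Sum>l<Suc k. w l) = W * (2 * real k + 1) / (2 * real n)" if "Suc k < n" for k
    using optimal_weights_partial_sums[OF w that] by (simp add: W_def)
  have w0: "w 0 = W / (2 * real n)"
    using S[of 0] n by simp
  have wk: "w (Suc k) = W / real n" if "Suc (Suc k) < n" for k
  proof -
    have "w (Suc k) = (\<Sum>l<Suc (Suc k). w l) - (\<Sum>l<Suc k. w l)" by simp
    also have "\<dots> = W * (2 * real (Suc k) + 1) / (2 * real n) - W * (2 * real k + 1) / (2 * real n)"
      using S[of k] S[of "Suc k"] that by simp
    also have "\<dots> = W / real n" using that by (simp add: field_simps)
    finally show ?thesis .
  qed
  obtain m where m: "n = Suc (Suc m)"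
    using n by (metis Suc_le_D numeral_2_eq_2 Suc_le_mono)
  \<comment> \<open>The formula for partial sums stops one index before the last node, whose weight
    is therefore what remains of \<open>W\<close>.\<close>
  have last: "w (Suc m) = 3 / 2 * W / real n"
  proof -
    have "w (Suc m) = W - (\<Sum>l<Suc m. w l)" by (simp add: W_def m)
    also have "\<dots> = W - W * (2 * real m + 1) / (2 * real n)"
      using S[of m] m by simp
    also have "\<dots> = 3 / 2 * W / real n"
      by (simp add: m field_simps)
    finally show ?thesis .
  qed
  \<comment> \<open>The extra \<open>F j / 2\<close> is the half of node \<open>j\<close> that
    belongs to the panel on its right, which the trapezoids up to node \<open>j\<close> do not
    contain.\<close>
  have part: "(\<Sum>k<Suc j. w k * F k) = W * ((\<Sum>k<j. (F k + F (Suc k)) / 2) + F j / 2) / real n"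
    if "Suc j < n" for j
    using that
  proof (induction j)
    case 0
    then show ?case by (simp add: w0)
  next
    case (Suc j)
    have "(\<Sum>k<Suc (Suc j). w k * F k) = (\<Sum>k<Suc j. w k * F k) + w (Suc j) * F (Suc j)"
      by simp
    also have "\<dots> = W * ((\<Sum>k<j. (F k + F (Suc k)) / 2) + F j / 2) / real n + W / real n * F (Suc j)"
      using Suc wk[of j] by simp
    also have "\<dots> = W * ((\<Sum>k<j. (F k + F (Suc k)) / 2) + F j / 2 + F (Suc j)) / real n"
      by (simp add: distrib_left add_divide_distrib)
    finally show ?case by (simp add: add_divide_distrib)
  qed
  have "quadrature n w f = (\<Sum>k<Suc m. w k * F k) + w (Suc m) * F (Suc m)"
    by (simp add: quadrature_def F_def m)
  also have "\<dots> = W * trapezoid_rectangle n f"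
  proof -
    have "(\<Sum>k<Suc m. w k * F k) + w (Suc m) * F (Suc m) =
        W * ((\<Sum>k<m. (F k + F (Suc k)) / 2) + F m / 2) / real n + 3 / 2 * W / real n * F (Suc m)"
      using part[of m] m by (simp only: last)
    also have "\<dots> = W * ((\<Sum>k<Suc m. (F k + F (Suc k)) / 2) + F (Suc m)) / real n"
      by (simp add: distrib_left add_divide_distrib)
    also have "\<dots> = W * trapezoid_rectangle n f"
      by (simp add: trapezoid_rectangle_def F_def m)
    finally show ?thesis .
  qed
  finally show ?thesis by (simp add: W_def)
qed

text \<open>The differences of the equations leave the total weight free; the equation at node 0
  fixes it. There the maximum in the kernel is the other node, since nodes are nonnegative.\<close>

lemma optimal_weights_normalization:
  assumes "optimal_weights n w" and "n \<ge> 2"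
  shows "(\<Sum>l<n. w l) * trapezoid_rectangle n (\<lambda>x. 4/3 + x\<^sup>2 / 2 - x) = 1"
proof -
  have "K1 (node n 0) (node n l) = 4/3 + (node n l)\<^sup>2 / 2 - node n l" for l
    by (simp add: K1_eq_max node_def)
  then have "quadrature n w (\<lambda>x. 4/3 + x\<^sup>2 / 2 - x) = (\<Sum>l<n. K1 (node n 0) (node n l) * w l)"
    by (simp add: quadrature_def mult.commute)
  also have "\<dots> = 1" using assms by (simp add: optimal_weights_def)
  finally show ?thesis using optimal_quadrature_eq[OF assms] by simp
qed

section \<open>The trapezoidal error on one panel\<close>

text \<open>The error \<open>G s\<close> on \<open>{a..s}\<close> vanishes at \<open>s = a\<close>,
  so two uses of the mean value theorem, for \<open>G\<close> and then for \<open>f\<close>, express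
  \<open>G b\<close> by an increment of \<open>f'\<close>. This form, rather than one with a second
  derivative, lets the errors of all panels be summed by absolute continuity of
  \<open>f'\<close>.\<close>

lemma trapezoid_panel_error:
  fixes f f' :: "real \<Rightarrow> real"
  assumes "a < b"
    and f': "\<And>x. x \<in> {a..b} \<Longrightarrow> (f has_real_derivative f' x) (at x within {a..b})"
  shows "\<exists>\<xi> \<eta>. a \<le> \<xi> \<and> \<xi> < \<eta> \<and> \<eta> \<le> b \<and>
           \<bar>integral {a..b} f - (b - a) * ((f a + f b) / 2)\<bar> \<le> (b - a)\<^sup>2 / 2 * \<bar>f' \<eta> - f' \<xi>\<bar>"
proof -
  define G where "G s = integral {a..s} f - (s - a) * (f a + f s) / 2" for s
  have cont: "continuous_on {a..b} f"
    using f' by (rule DERIV_continuous_on)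
  have dG: "(G has_real_derivative ((f s - f a) / 2 - (s - a) * f' s / 2)) (at s within {a..b})"
    if s: "s \<in> {a..b}" for s
    unfolding G_def
    by (rule DERIV_cong, rule DERIV_diff[OF integral_has_real_derivative[OF cont s]
          DERIV_cdivide[OF DERIV_mult[OF DERIV_diff[OF DERIV_ident DERIV_const]
          DERIV_add[OF DERIV_const f'[OF s]]]]])
       (simp add: field_simps)
  obtain \<eta> where \<eta>: "a < \<eta>" "\<eta> < b"
    "G b - G a = ((f \<eta> - f a) / 2 - (\<eta> - a) * f' \<eta> / 2) * (b - a)"
    using mvt_simple[OF \<open>a < b\<close>, of G "\<lambda>s. (*) ((f s - f a) / 2 - (s - a) * f' s / 2)"] dG
    by (auto simp: has_field_derivative_def)
  \<comment> \<open>The derivative of \<open>G\<close> at \<eta> still contains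
    \<open>f \<eta> - f a\<close>; the mean value theorem on \<open>{a..\<eta>}\<close> turns it
    into a value of \<open>f'\<close>.\<close>
  have "(f has_derivative (*) (f' x)) (at x within {a..\<eta>})" if "x \<in> {a..\<eta>}" for x
    using f'[of x] that \<eta>
    by (auto simp: has_field_derivative_def intro: has_derivative_subset)
  from mvt_simple[OF \<eta>(1) this] obtain \<xi> where \<xi>: "a < \<xi>" "\<xi> < \<eta>" "f \<eta> - f a = f' \<xi> * (\<eta> - a)"
    by auto
  have "integral {a..b} f - (b - a) * ((f a + f b) / 2) = G b - G a"
    by (simp add: G_def)
  also have "\<dots> = (\<eta> - a) * (b - a) / 2 * (f' \<xi> - f' \<eta>)"
    by (simp add: \<eta> \<xi> field_simps)
  also have "\<bar>\<dots>\<bar> = (\<eta> - a) * (b - a) / 2 * \<bar>f' \<eta> - f' \<xi>\<bar>"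
    using \<eta> by (simp add: abs_mult abs_minus_commute)
  also have "\<dots> \<le> (b - a)\<^sup>2 / 2 * \<bar>f' \<eta> - f' \<xi>\<bar>"
    using \<eta> unfolding power2_eq_square by (intro mult_right_mono divide_right_mono) auto
  finally show ?thesis using \<eta> \<xi> by (intro exI[of _ \<xi>] exI[of _ \<eta>]) auto
qed

section \<open>Absolute continuity and increments within panels\<close>

text \<open>The definition sums over a set of pairs, whereas panels come as indexed families.
  Reindexing is sound because two indices with the same interval would make that interval disjoint
  from itself, hence empty.\<close>

lemma abs_continuous_onD_indexed:
  fixes f :: "real \<Rightarrow> real"
  assumes "abs_continuous_on S f" and "\<epsilon> > 0"
  obtains \<delta> where "\<delta> > 0"
    "\<And>I :: nat set. \<And>a b. finite I \<Longrightarrow> (\<And>k. k \<in> I \<Longrightarrow> a k < b k \<and> {a k..b k} \<subseteq> S) \<Longrightarrow>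
       disjoint_family_on (\<lambda>k. {a k<..<b k}) I \<Longrightarrow> (\<Sum>k\<in>I. b k - a k) < \<delta> \<Longrightarrow>
       (\<Sum>k\<in>I. \<bar>f (b k) - f (a k)\<bar>) < \<epsilon>"
proof -
  obtain \<delta> where \<delta>: "\<delta> > 0" and D: "\<And>P :: (real \<times> real) set.
        finite P \<and> (\<forall>(a, b)\<in>P. a < b \<and> {a..b} \<subseteq> S) \<and>
        disjoint_family_on (\<lambda>(a, b). {a<..<b}) P \<and>
        (\<Sum>(a, b)\<in>P. b - a) < \<delta>
        \<Longrightarrow> (\<Sum>(a, b)\<in>P. \<bar>f b - f a\<bar>) < \<epsilon>"
    using assms unfolding abs_continuous_on_def by meson
  show thesis
  proof (rule that[OF \<delta>])
    fix I :: "nat set" and a b :: "nat \<Rightarrow> real"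
    assume I: "finite I" and ab: "\<And>k. k \<in> I \<Longrightarrow> a k < b k \<and> {a k..b k} \<subseteq> S"
      and dis: "disjoint_family_on (\<lambda>k. {a k<..<b k}) I" and len: "(\<Sum>k\<in>I. b k - a k) < \<delta>"
    let ?p = "\<lambda>k. (a k, b k)"
    have inj: "inj_on ?p I"
    proof (rule inj_onI, rule ccontr)
      fix i j assume ij: "i \<in> I" "j \<in> I" "?p i = ?p j" "i \<noteq> j"
      then have "{a i<..<b i} \<inter> {a j<..<b j} = {}"
        using dis unfolding disjoint_family_on_def by blast
      then have "{a i<..<b i} = {}" using ij by simp
      then show False using ab[of i] ij by simp
    qed
    have "(\<Sum>(a, b)\<in>?p ` I. \<bar>f b - f a\<bar>) < \<epsilon>"
    proof (rule D, intro conjI)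
      show "finite (?p ` I)" using I by simp
      show "\<forall>(a, b)\<in>?p ` I. a < b \<and> {a..b} \<subseteq> S" using ab by auto
      show "disjoint_family_on (\<lambda>(a, b). {a<..<b}) (?p ` I)"
        unfolding disjoint_family_on_def
      proof (intro ballI impI)
        fix p q assume "p \<in> ?p ` I" "q \<in> ?p ` I" "p \<noteq> q"
        then obtain i j where "i \<in> I" "j \<in> I" "i \<noteq> j" "p = ?p i" "q = ?p j" by auto
        then show "(case p of (a, b) \<Rightarrow> {a<..<b}) \<inter> (case q of (a, b) \<Rightarrow> {a<..<b}) = {}"
          using dis unfolding disjoint_family_on_def by auto
      qed
      show "(\<Sum>(a, b)\<in>?p ` I. b - a) < \<delta>"
        using len by (simp add: sum.reindex[OF inj])
    qed
    then show "(\<Sum>k\<in>I. \<bar>f (b k) - f (a k)\<bar>) < \<epsilon>"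
      by (simp add: sum.reindex[OF inj])
  qed
qed

lemma abs_continuous_on_imp_continuous_on:
  fixes f :: "real \<Rightarrow> real"
  assumes "abs_continuous_on {c..d} f"
  shows "continuous_on {c..d} f"
  unfolding continuous_on_iff
proof (intro ballI allI impI)
  fix x \<epsilon> :: real assume x: "x \<in> {c..d}" and "\<epsilon> > 0"
  obtain \<delta> where \<delta>: "\<delta> > 0"
    and D: "\<And>I :: nat set. \<And>a b. finite I \<Longrightarrow> (\<And>k. k \<in> I \<Longrightarrow> a k < b k \<and> {a k..b k} \<subseteq> {c..d}) \<Longrightarrow>
       disjoint_family_on (\<lambda>k. {a k<..<b k}) I \<Longrightarrow> (\<Sum>k\<in>I. b k - a k) < \<delta> \<Longrightarrow>
       (\<Sum>k\<in>I. \<bar>f (b k) - f (a k)\<bar>) < \<epsilon>"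
    using abs_continuous_onD_indexed[OF assms \<open>\<epsilon> > 0\<close>] by blast
  \<comment> \<open>A single interval is taken as a family with one index.\<close>
  have *: "\<bar>f v - f u\<bar> < \<epsilon>" if "u < v" "u \<in> {c..d}" "v \<in> {c..d}" "v - u < \<delta>" for u v
    using D[of "{0}" "\<lambda>_. u" "\<lambda>_. v"] that by (auto simp: disjoint_family_on_def)
  have "dist (f y) (f x) < \<epsilon>" if "y \<in> {c..d}" "dist y x < \<delta>" for y
    using that x \<open>\<epsilon> > 0\<close> *[of x y] *[of y x]
    by (cases x y rule: linorder_cases) (auto simp: dist_real_def abs_minus_commute)
  then show "\<exists>\<delta>>0. \<forall>y\<in>{c..d}. dist y x < \<delta> \<longrightarrow> dist (f y) (f x) < \<epsilon>"
    using \<delta> by blast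
qed

text \<open>Within a residue class an index is determined by its quotient by \<open>M\<close>, which
  is at most \<open>n div M\<close>. This bounds the number of panels in a group.\<close>

lemma card_residue_class_le:
  fixes M n r :: nat
  shows "card {k. k < n \<and> k mod M = r} \<le> Suc (n div M)"
proof -
  have "inj_on (\<lambda>k. k div M) {k. k < n \<and> k mod M = r}"
    by (rule inj_onI) (metis (mono_tags, lifting) mem_Collect_eq div_mult_mod_eq)
  then have "card {k. k < n \<and> k mod M = r} \<le> card {..n div M}"
    by (rule card_inj_on_le) (auto intro: div_le_mono)
  then show ?thesis by simp
qed

text \<open>
  The panels are grouped by the residue of their index modulo a fixed \<open>M\<close>, so that each of the \<open>M\<close>
  groups is short enough for absolute continuity to apply with \<open>\<epsilon> = 1\<close>.
\<close>

lemma abs_continuous_on_panel_increments: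
  fixes g :: "real \<Rightarrow> real"
  assumes "abs_continuous_on {0..1} g"
  obtains M where "M > 0"
    "\<And>n a b. n \<ge> M \<Longrightarrow> (\<And>k. k < n \<Longrightarrow> node n k \<le> a k \<and> a k < b k \<and> b k \<le> node n (Suc k)) \<Longrightarrow>
       (\<Sum>k<n. \<bar>g (b k) - g (a k)\<bar>) \<le> real M"
proof -
  obtain \<delta> where \<delta>: "\<delta> > 0"
    and D: "\<And>I :: nat set. \<And>a b. finite I \<Longrightarrow> (\<And>k. k \<in> I \<Longrightarrow> a k < b k \<and> {a k..b k} \<subseteq> {0..1}) \<Longrightarrow>
       disjoint_family_on (\<lambda>k. {a k<..<b k}) I \<Longrightarrow> (\<Sum>k\<in>I. b k - a k) < \<delta> \<Longrightarrow>
       (\<Sum>k\<in>I. \<bar>g (b k) - g (a k)\<bar>) < 1"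
    using abs_continuous_onD_indexed[OF assms zero_less_one] by blast
  \<comment> \<open>A group has at most \<open>n / M + 1\<close> panels of width
    \<open>1 / n\<close>; for \<open>n \<ge> M\<close> its total length is at most
    \<open>2 / M\<close>, hence the factor 2.\<close>
  obtain M where M: "M > 0" "1 / real M < \<delta> / 2"
    using \<delta> by (metis reals_Archimedean2 half_gt_zero real_arch_inverse inverse_eq_divide neq0_conv)
  show thesis
  proof (rule that[OF \<open>M > 0\<close>])
    fix n a b
    assume n: "n \<ge> M"
      and ab: "\<And>k. k < n \<Longrightarrow> node n k \<le> a k \<and> a k < b k \<and> b k \<le> node n (Suc k)"
    have npos: "real n > 0" using n M by simp
    have disj: "{a i<..<b i} \<inter> {a j<..<b j} = {}" if "i < j" "j < n" for i j
    proof -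
      have "b i \<le> node n (Suc i)" using ab[of i] that by simp
      also have "\<dots> \<le> node n j" using that npos by (simp add: node_def divide_right_mono)
      also have "\<dots> \<le> a j" using ab[of j] that by simp
      finally show ?thesis by auto
    qed
    have grp: "(\<Sum>k | k \<in> {..<n} \<and> k mod M = r. \<bar>g (b k) - g (a k)\<bar>) \<le> 1" for r
    proof (rule less_imp_le, rule D)
      let ?I = "{k. k \<in> {..<n} \<and> k mod M = r}"
      show "finite ?I" by simp
      show "a k < b k \<and> {a k..b k} \<subseteq> {0..1}" if "k \<in> ?I" for k
      proof -
        have "0 \<le> node n k" "node n (Suc k) \<le> 1" using that npos by (auto simp: node_def)
        then show ?thesis using ab[of k] that by auto
      qed
      show "disjoint_family_on (\<lambda>k. {a k<..<b k}) ?I"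
        unfolding disjoint_family_on_def
      proof (intro ballI impI)
        fix i j assume "i \<in> ?I" "j \<in> ?I" "i \<noteq> j"
        then show "{a i<..<b i} \<inter> {a j<..<b j} = {}"
          using disj[of i j] disj[of j i] by (cases i j rule: linorder_cases) auto
      qed
      have "(\<Sum>k\<in>?I. b k - a k) \<le> (\<Sum>k\<in>?I. 1 / real n)"
      proof (rule sum_mono)
        fix k assume "k \<in> ?I"
        then have "b k - a k \<le> node n (Suc k) - node n k" using ab[of k] by auto
        also have "\<dots> = 1 / real n" by (simp add: node_def diff_divide_distrib[symmetric])
        finally show "b k - a k \<le> 1 / real n" .
      qed
      also have "\<dots> = real (card ?I) / real n" by simp
      also have "\<dots> \<le> (real n / real M + 1) / real n"
      proof -
        have "real (card ?I) \<le> real (n div M) + 1"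
          using card_residue_class_le[of n M r] by (simp add: lessThan_def)
        also have "real (n div M) \<le> real n / real M" by (rule of_nat_div_le_of_nat)
        finally show ?thesis using npos by (intro divide_right_mono) auto
      qed
      also have "\<dots> \<le> 1 / real M + 1 / real M"
        using npos n M by (simp add: field_simps)
      also have "\<dots> < \<delta>" using M by simp
      finally show "(\<Sum>k\<in>?I. b k - a k) < \<delta>" .
    qed
    \<comment> \<open>There are \<open>M\<close> residues and each contributes at most 1, so the
      bound does not depend on \<open>n\<close>.\<close>
    have "(\<Sum>k<n. \<bar>g (b k) - g (a k)\<bar>) =
          (\<Sum>r<M. \<Sum>k | k \<in> {..<n} \<and> k mod M = r. \<bar>g (b k) - g (a k)\<bar>)"
      using M by (intro sum.group[symmetric]) auto
    also have "\<dots> \<le> (\<Sum>r<M. 1)" by (intro sum_mono grp)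
    finally show "(\<Sum>k<n. \<bar>g (b k) - g (a k)\<bar>) \<le> real M" by simp
  qed
qed

section \<open>The error of the composite rule\<close>

lemma integral_sum_panels:
  fixes f :: "real \<Rightarrow> real"
  assumes "continuous_on {0..1} f" and "m \<le> n" and "n > 0"
  shows "integral {0..node n m} f = (\<Sum>k<m. integral {node n k..node n (Suc k)} f)"
  using assms(2)
proof (induction m)
  case 0
  then show ?case by (simp add: node_def)
next
  case (Suc m)
  have o: "0 \<le> node n m" "node n m \<le> node n (Suc m)" "node n (Suc m) \<le> 1"
    using Suc.prems \<open>n > 0\<close> by (auto simp: node_def divide_right_mono)
  have "f integrable_on {0..node n (Suc m)}"
    using o by (intro integrable_continuous_interval continuous_on_subset[OF assms(1)]) auto
  from Henstock_Kurzweil_Integration.integral_combine[OF o(1,2) this] show ?case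
    using Suc by simp
qed

text \<open>The trapezoidal errors carry the factor \<open>1 / n^2\<close> and the increments of
  \<open>f'\<close> have a bounded sum. The rectangle is only of first order, but it is used on a
  single panel: a deviation of at most \<open>B / n\<close> over a length \<open>1 / n\<close> again
  costs \<open>B / n^2\<close>.\<close>

lemma trapezoid_rectangle_error:
  fixes f f' :: "real \<Rightarrow> real"
  assumes f': "\<And>x. x \<in> {0..1} \<Longrightarrow> (f has_real_derivative f' x) (at x within {0..1})"
    and ac: "abs_continuous_on {0..1} f'"
  obtains C where
    "eventually (\<lambda>n. \<bar>trapezoid_rectangle n f - integral {0..1} f\<bar> \<le> C / (real n)\<^sup>2) sequentially"
proof -
  have cont: "continuous_on {0..1} f" using f' by (rule DERIV_continuous_on)
  have "bounded (f' ` {0..1})"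
    using abs_continuous_on_imp_continuous_on[OF ac]
    by (intro compact_imp_bounded compact_continuous_image) auto
  \<comment> \<open>\<open>B\<close> bounds the continuous \<open>f'\<close> on a compact interval
    and serves as a Lipschitz constant of \<open>f\<close> for the last panel.\<close>
  then obtain B where B: "\<And>x. x \<in> {0..1} \<Longrightarrow> \<bar>f' x\<bar> \<le> B"
    unfolding bounded_iff by (metis imageI real_norm_def)
  have B0: "0 \<le> B" using B[of 0] by auto
  have lip: "\<bar>f y - f x\<bar> \<le> B * \<bar>y - x\<bar>" if "x \<in> {0..1}" "y \<in> {0..1}" for x y
    using field_differentiable_bound[of "{0..1}" f f' B y x] f' B that by auto
  obtain M where M: "M > 0" and MB:
    "\<And>n a b. n \<ge> M \<Longrightarrow> (\<And>k. k < n \<Longrightarrow> node n k \<le> a k \<and> a k < b k \<and> b k \<le> node n (Suc k)) \<Longrightarrow>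
       (\<Sum>k<n. \<bar>f' (b k) - f' (a k)\<bar>) \<le> real M"
    using abs_continuous_on_panel_increments[OF ac] by blast
  have bound: "\<bar>trapezoid_rectangle n f - integral {0..1} f\<bar> \<le> (real M / 2 + B) / (real n)\<^sup>2"
    if n: "n \<ge> M" for n
  proof -
    have n0: "n > 0" using n M by simp
    define I where "I k = integral {node n k..node n (Suc k)} f" for k
    define t where "t k = (f (node n k) + f (node n (Suc k))) / 2 / real n" for k
    have h: "node n (Suc k) - node n k = 1 / real n" for k
      by (simp add: node_def diff_divide_distrib[symmetric])
    have h0: "1 / real n > 0" using n0 by simp
    have sub: "{node n k..node n (Suc k)} \<subseteq> {0..1}" if "k < n" for k
      using that by (auto simp: node_def field_simps intro: order_trans[rotated])
    have "\<forall>k\<in>{..<n}. \<exists>\<xi> \<eta>. node n k \<le> \<xi> \<and> \<xi> < \<eta> \<and> \<eta> \<le> node n (Suc k) \<and>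
            \<bar>I k - t k\<bar> \<le> 1 / (real n)\<^sup>2 / 2 * \<bar>f' \<eta> - f' \<xi>\<bar>"
    proof
      fix k assume "k \<in> {..<n}"
      then have k: "k < n" by simp
      have "(f has_real_derivative f' x) (at x within {node n k..node n (Suc k)})"
        if "x \<in> {node n k..node n (Suc k)}" for x
        using f'[of x] sub[OF k] that by (meson DERIV_subset subsetD)
      moreover have "node n k < node n (Suc k)" using h[of k] h0 by linarith
      ultimately show "\<exists>\<xi> \<eta>. node n k \<le> \<xi> \<and> \<xi> < \<eta> \<and> \<eta> \<le> node n (Suc k) \<and>
            \<bar>I k - t k\<bar> \<le> 1 / (real n)\<^sup>2 / 2 * \<bar>f' \<eta> - f' \<xi>\<bar>"
        using trapezoid_panel_error[of "node n k" "node n (Suc k)" f f']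
        by (simp add: h I_def t_def power_one_over mult.commute)
    qed
    then obtain \<xi> \<eta> where \<xi>\<eta>: "\<And>k. k < n \<Longrightarrow> node n k \<le> \<xi> k \<and> \<xi> k < \<eta> k \<and> \<eta> k \<le> node n (Suc k) \<and>
            \<bar>I k - t k\<bar> \<le> 1 / (real n)\<^sup>2 / 2 * \<bar>f' (\<eta> k) - f' (\<xi> k)\<bar>"
      by (metis lessThan_iff)
    \<comment> \<open>Including the last panel only enlarges the sum, and the bound on increments is
      stated for all \<open>n\<close> panels together.\<close>
    have "(\<Sum>k<n-1. \<bar>I k - t k\<bar>) \<le> (\<Sum>k<n. \<bar>I k - t k\<bar>)"
      by (rule sum_mono2) auto
    also have "\<dots> \<le> (\<Sum>k<n. 1 / (real n)\<^sup>2 / 2 * \<bar>f' (\<eta> k) - f' (\<xi> k)\<bar>)"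
      using \<xi>\<eta> by (intro sum_mono) auto
    also have "\<dots> = 1 / (real n)\<^sup>2 / 2 * (\<Sum>k<n. \<bar>f' (\<eta> k) - f' (\<xi> k)\<bar>)"
      by (simp only: sum_distrib_left)
    also have "\<dots> \<le> 1 / (real n)\<^sup>2 / 2 * real M"
      using MB[OF n, of \<xi> \<eta>] \<xi>\<eta> by (intro mult_left_mono) auto
    finally have trap: "(\<Sum>k<n-1. \<bar>I k - t k\<bar>) \<le> real M / 2 / (real n)\<^sup>2" by simp
    let ?c = "node n (n - 1)"
    have c1: "node n (Suc (n - 1)) = 1" using n0 by (simp add: node_def)
    have c01: "0 \<le> ?c" "?c \<le> 1" "1 - ?c = 1 / real n"
      using n0 h[of "n - 1"] c1 by (auto simp: node_def)
    have int: "f integrable_on {?c..1}"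
      using c01 by (intro integrable_continuous_interval continuous_on_subset[OF cont]) auto
    have "I (n - 1) - f ?c / real n = integral {?c..1} f - integral {?c..1} (\<lambda>_. f ?c)"
      unfolding I_def c1 using c01 by simp
    also have "\<dots> = integral {?c..1} (\<lambda>x. f x - f ?c)"
      by (rule Henstock_Kurzweil_Integration.integral_diff[symmetric]) (use int in auto)
    also have "\<bar>\<dots>\<bar> \<le> B * (1 / real n) * (1 - ?c)"
    proof -
      have "norm (integral {?c..1} (\<lambda>x. f x - f ?c)) \<le> B * (1 / real n) * (1 - ?c)"
      proof (rule integral_bound)
        show "continuous_on {?c..1} (\<lambda>x. f x - f ?c)"
          using c01 by (intro continuous_intros continuous_on_subset[OF cont]) auto
        fix x assume x: "x \<in> {?c..1}"
        have "\<bar>f x - f ?c\<bar> \<le> B * \<bar>x - ?c\<bar>" using lip[of ?c x] x c01 by auto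
        also have "\<dots> \<le> B * (1 / real n)" using x c01 B0 by (intro mult_left_mono) auto
        finally show "norm (f x - f ?c) \<le> B * (1 / real n)" by simp
      qed (use c01 in auto)
      then show ?thesis by simp
    qed
    finally have rect: "\<bar>I (n - 1) - f ?c / real n\<bar> \<le> B / (real n)\<^sup>2"
      unfolding c01(3) by (simp add: power2_eq_square)
    have "integral {0..1} f = (\<Sum>k<n. I k)"
      using integral_sum_panels[OF cont order_refl n0] n0 by (simp add: I_def node_def)
    also have "\<dots> = (\<Sum>k<n-1. I k) + I (n - 1)"
      using n0 by (metis Suc_diff_1 sum.lessThan_Suc)
    finally have "trapezoid_rectangle n f - integral {0..1} f =
        - ((\<Sum>k<n-1. I k - t k) + (I (n - 1) - f ?c / real n))"
      by (simp add: trapezoid_rectangle_def t_def sum_subtractf add_divide_distrib sum_divide_distrib)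
    then have "\<bar>trapezoid_rectangle n f - integral {0..1} f\<bar> \<le>
        (\<Sum>k<n-1. \<bar>I k - t k\<bar>) + \<bar>I (n - 1) - f ?c / real n\<bar>"
      using sum_abs[of "\<lambda>k. I k - t k" "{..<n-1}"] by linarith
    also have "\<dots> \<le> (real M / 2 + B) / (real n)\<^sup>2"
      using trap rect by (simp add: add_divide_distrib)
    finally show ?thesis .
  qed
  show thesis
    by (rule that, rule eventually_sequentiallyI[of M], rule bound)
qed

section \<open>The total weight and the convergence rate\<close>

text \<open>If \<open>T\<close> is the value of the rule at \<open>g\<close>, the normalization
  reads \<open>W * T = 1\<close>, so \<open>W - 1 = W * (1 - T)\<close> inherits the order of
  \<open>T - 1\<close> once \<open>W\<close> is bounded. The bound on \<open>W\<close> is kept in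
  the conclusion because \<open>W\<close> later multiplies the error for \<open>f\<close>.\<close>

lemma optimal_weights_sum_error:
  assumes w: "\<And>n. n \<ge> 1 \<Longrightarrow> optimal_weights n (w n)"
  obtains C where "C \<ge> 0"
    "eventually (\<lambda>n. \<bar>\<Sum>l<n. w n l\<bar> \<le> 2 \<and> \<bar>(\<Sum>l<n. w n l) - 1\<bar> \<le> C / (real n)\<^sup>2) sequentially"
proof -
  \<comment> \<open>On \<open>{0..1}\<close> this is the kernel section \<open>K1 0\<close>.\<close>
  define g where "g x = 4/3 + x\<^sup>2 / 2 - x" for x :: real
  have dg: "(g has_real_derivative (x - 1)) (at x within S)" for x S
    unfolding g_def by (auto intro!: derivative_eq_intros)
  have "((\<lambda>x. 4/3 + x\<^sup>2 / 2 - x) has_integral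
          ((4/3 * 1 + 1^3 / 6 - 1\<^sup>2 / 2) - (4/3 * 0 + 0^3 / 6 - 0\<^sup>2 / 2))) {0..1::real}"
    by (rule fundamental_theorem_of_calculus)
       (auto intro!: derivative_eq_intros simp: power2_eq_square
             simp flip: has_real_derivative_iff_has_vector_derivative)
  then have ig: "integral {0..1} g = 1"
    unfolding g_def by (simp add: integral_unique)
  have ac: "abs_continuous_on {0..1} (\<lambda>x. x - 1)"
    unfolding abs_continuous_on_def
  \<comment> \<open>The witness for \<delta> is \<epsilon> itself: the increments are the lengths of
    the intervals.\<close>
  proof (intro allI impI, rule exI, intro conjI allI impI)
    fix \<epsilon> :: real and P :: "(real \<times> real) set"
    assume P: "finite P \<and> (\<forall>(a, b)\<in>P. a < b \<and> {a..b} \<subseteq> {0..1}) \<and>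
        disjoint_family_on (\<lambda>(a, b). {a<..<b}) P \<and> (\<Sum>(a, b)\<in>P. b - a) < \<epsilon>"
    then have "(\<Sum>(a, b)\<in>P. \<bar>(b - 1) - (a - 1)\<bar>) = (\<Sum>(a, b)\<in>P. b - a)"
      by (intro sum.cong) auto
    then show "(\<Sum>(a, b)\<in>P. \<bar>(b - 1) - (a - 1)\<bar>) < \<epsilon>" using P by simp
  qed
  obtain C where C: "eventually (\<lambda>n. \<bar>trapezoid_rectangle n g - 1\<bar> \<le> C / (real n)\<^sup>2) sequentially"
    using trapezoid_rectangle_error[OF dg ac] by (auto simp: ig)
  have "(\<lambda>n. C / (real n)\<^sup>2) \<longlonglongrightarrow> 0"
    by real_asymp
  \<comment> \<open>The threshold 1/2 gives \<open>T \<ge> 1 / 2\<close>, whence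
    \<open>W \<le> 2\<close>. The sign of \<open>C\<close> is unknown, so the final constant is
    \<open>2 * \<bar>C\<bar>\<close>.\<close>
  then have "eventually (\<lambda>n. C / (real n)\<^sup>2 < 1 / 2) sequentially"
    by (rule order_tendstoD) simp
  with C have "eventually (\<lambda>n. \<bar>\<Sum>l<n. w n l\<bar> \<le> 2 \<and>
      \<bar>(\<Sum>l<n. w n l) - 1\<bar> \<le> 2 * \<bar>C\<bar> / (real n)\<^sup>2) sequentially"
    using eventually_ge_at_top[of 2]
  proof eventually_elim
    case (elim n)
    define W T where "W = (\<Sum>l<n. w n l)" and "T = trapezoid_rectangle n g"
    have WT: "W * T = 1"
      using optimal_weights_normalization[OF w, of n] elim by (simp add: W_def T_def g_def[abs_def])
    have T: "\<bar>T - 1\<bar> \<le> C / (real n)\<^sup>2" "T \<ge> 1 / 2"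
      using elim(1,2) unfolding T_def by linarith+
    have "W = 1 / T" using WT T by (simp add: field_simps)
    then have W: "\<bar>W\<bar> \<le> 2" using T(2) by (simp add: divide_le_eq)
    have "W - 1 = W * (1 - T)" using WT by (simp add: algebra_simps)
    then have "\<bar>W - 1\<bar> = \<bar>W\<bar> * \<bar>T - 1\<bar>" by (simp add: abs_mult abs_minus_commute)
    also have "\<dots> \<le> 2 * (C / (real n)\<^sup>2)" using W T by (intro mult_mono) auto
    also have "\<dots> \<le> 2 * \<bar>C\<bar> / (real n)\<^sup>2" by (simp add: divide_right_mono)
    finally show ?case using W by (simp add: W_def)
  qed
  then show thesis by (rule that[rotated]) simp
qed

theorem lemma2:
  fixes f :: "real \<Rightarrow> real" and w :: "nat \<Rightarrow> nat \<Rightarrow> real"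
  assumes "\<And>n. n \<ge> 1 \<Longrightarrow> optimal_weights n (w n)"
    and "f \<in> sobolev 2"
  shows "(\<lambda>n. \<bar>integral {0..1} f - quadrature n (w n) f\<bar>) \<in> O(\<lambda>n. 1 / (real n)\<^sup>2)"
proof -
  obtain D where "D 0 = f" "\<forall>\<tau><2. abs_continuous_on {0..1} (D \<tau>)"
    "\<forall>\<tau><1. \<forall>x\<in>{0..1}. (D \<tau> has_real_derivative D (Suc \<tau>) x) (at x within {0..1})"
    using assms(2) by (auto simp: sobolev_def)
  \<comment> \<open>For smoothness 2 the function \<open>D 1\<close> is the classical derivative of
    \<open>f\<close> and absolutely continuous, as the estimate for the composite rule
    requires.\<close>
  then have "\<And>x. x \<in> {0..1} \<Longrightarrow> (f has_real_derivative D 1 x) (at x within {0..1})"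
    and "abs_continuous_on {0..1} (D 1)"
    by auto
  from trapezoid_rectangle_error[OF this] obtain C where C:
    "eventually (\<lambda>n. \<bar>trapezoid_rectangle n f - integral {0..1} f\<bar> \<le> C / (real n)\<^sup>2) sequentially"
    by blast
  obtain E where E: "E \<ge> 0"
    "eventually (\<lambda>n. \<bar>\<Sum>l<n. w n l\<bar> \<le> 2 \<and> \<bar>(\<Sum>l<n. w n l) - 1\<bar> \<le> E / (real n)\<^sup>2) sequentially"
    using optimal_weights_sum_error[OF assms(1)] by blast
  define J where "J = integral {0..1} f"
  have "eventually (\<lambda>n. norm \<bar>J - quadrature n (w n) f\<bar> \<le>
          (2 * C + E * \<bar>J\<bar>) * norm (1 / (real n)\<^sup>2)) sequentially"
    using C E(2) eventually_ge_at_top[of 2]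
  proof eventually_elim
    case (elim n)
    define W T where "W = (\<Sum>l<n. w n l)" and "T = trapezoid_rectangle n f"
    have "quadrature n (w n) f = W * T"
      using optimal_quadrature_eq[OF assms(1), of n] elim by (simp add: W_def T_def)
    \<comment> \<open>The error splits into that of the rule without \<open>W\<close>, scaled by the
      bounded \<open>W\<close>, and the defect of the total weight, scaled by the fixed number
      \<open>J\<close>; both are of order \<open>1 / n^2\<close>.\<close>
    then have "J - quadrature n (w n) f = - (W * (T - J) + (W - 1) * J)"
      by (simp add: algebra_simps)
    then have "\<bar>J - quadrature n (w n) f\<bar> \<le> \<bar>W\<bar> * \<bar>T - J\<bar> + \<bar>W - 1\<bar> * \<bar>J\<bar>"
      by (metis abs_minus_cancel abs_mult abs_triangle_ineq)
    also have "\<dots> \<le> 2 * (C / (real n)\<^sup>2) + E / (real n)\<^sup>2 * \<bar>J\<bar>"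
      using elim by (intro add_mono mult_mono) (auto simp: W_def T_def J_def)
    also have "\<dots> = (2 * C + E * \<bar>J\<bar>) * (1 / (real n)\<^sup>2)"
      by (simp add: add_divide_distrib)
    finally show ?case by simp
  qed
  then show ?thesis unfolding J_def by (rule bigoI)
qed

end
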